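(* Let $K$ be a global function field with constant field $\mathbb{F}_q$ and let $\mathcal{S}$ be a subset of the set of primes in $K$. Let $f:\mathbb{N}\to\mathbb{C}$ be an arithmetic function with $f(0)=0$ (here $0\in\mathbb{N}$). For any effective divisor $A\in\mathfrak{D}^+$ and any positive integer $k$, $$\sum_{\substack{B\in\mathfrak{D}(K,\mathcal{S})\\ B\le A}}\mu(B)\binom{\Omega(B)-1}{k-1}f(\delta_1(B))=(-1)^k\,Q_{\mathcal{S}}^{(k)}(A)\,f(\Delta_k(A)).$$
   Context: A global function field is a finite extension of $\mathbb{F}_q(T)$. A prime in $K$ is a discrete valuation ring $R_P$ with maximal ideal $P$ such that $\mathbb{F}_q\subset R_P$ and the quotient field of $R_P$ is $K$; its degree is $\deg P=[R_P/P:\mathbb{F}_q]$. Let $\mathcal{P}$ be the set of primes in $K$. The divisor group $\mathfrak{D}$ is the free abelian group on $\mathcal{P}$, consisting of finite formal sums $\sum_{P}a_P P$ with $a_P\in\mathbb{Z}$; $\mathfrak{D}^+$ is the set of effective divisors, those with all $a_P\ge 0$. For $D=\sum_P a_P P$, write $P\mid D$ if $a_P\neq 0$. For $A,B\in\mathfrak{D}$, $B\le A$ means that $A-B$ is effective. For an effective divisor $D$: $\mu(D)=1$ if $D=0$; $\mu(D)=(-1)^k$ if $D=P_1+\cdots+P_k$ for distinct primes $P_i$, $k>0$; and $\mu(D)=0$ otherwise. $\mathcal{N}(D)=\{\deg P: P\text{ prime}, P\mid D\}$ and $\Omega(D)=\#\mathcal{N}(D)$ (the number of distinct degrees). $\Delta_k(D)$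 and $\delta_k(D)$ are the $k$-th largest and $k$-th smallest elements of $\mathcal{N}(D)$, with $\Delta_k(D)=\delta_k(D)=0$ for $k>\Omega(D)$. $P_{\min}(D)=\{P\text{ prime}: P\mid D,\ \deg P=\delta_1(D)\}$. $\mathfrak{D}(K,\mathcal{S})$ is the set of $D\in\mathfrak{D}^+$ such that $P_{\min}(D)$ has exactly one element $P$ and $P\in\mathcal{S}$ (so $0\notin\mathfrak{D}(K,\mathcal{S})$). $Q_{\mathcal{S}}^{(k)}(D)=\#\{P\in\mathcal{S}: P\mid D,\ \deg P=\Delta_k(D)\}$. *)

theory Defs
  imports
    Complex_Main
    "HOL-Algebra.Finite_Extensions"
    "HOL-Algebra.Generated_Fields"
    "HOL-Algebra.Free_Abelian_Groups"
begin

section \<open>Global function fields\<close>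

text \<open>The finite field with q elements is the subset F of the carrier of K (so q = card F), and
  T is an element of K that is transcendental over F.\<close>

definition global_function_field :: "('a, 'b) ring_scheme \<Rightarrow> 'a set \<Rightarrow> bool" where
  "global_function_field K F \<longleftrightarrow>
     field K \<and> subfield F K \<and> finite F \<and>
     (\<exists>T \<in> carrier K. ring.transcendental K F T \<and>
        ring.finite_dimension K (generate_field K (F \<union> {T})) (carrier K))"

definition constant_field :: "('a, 'b) ring_scheme \<Rightarrow> 'a set \<Rightarrow> 'a set" where
  "constant_field K F = {x \<in> carrier K. ring.algebraic K F x}"


section \<open>Primes\<close>

definition discrete_valuation_ring :: "('a, 'b) ring_scheme \<Rightarrow> bool" where
  "discrete_valuation_ring R \<longleftrightarrow>
     principal_domain R \<and> \<not> field R \<and> (\<exists>!P. maximalideal P R)"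

text \<open>A prime is represented by the carrier V of its valuation ring; the maximal ideal is
  determined by V.\<close>

definition primes :: "('a, 'b) ring_scheme \<Rightarrow> 'a set \<Rightarrow> 'a set set" where
  "primes K F =
     {V. subring V K \<and> F \<subseteq> V \<and> discrete_valuation_ring (K\<lparr>carrier := V\<rparr>) \<and>
         (\<forall>x \<in> carrier K. \<exists>a \<in> V. \<exists>b \<in> V - {\<zero>\<^bsub>K\<^esub>}. x = a \<otimes>\<^bsub>K\<^esub> inv\<^bsub>K\<^esub> b)}"

definition prime_ideal :: "('a, 'b) ring_scheme \<Rightarrow> 'a set \<Rightarrow> 'a set" where
  "prime_ideal K V = (THE P. maximalideal P (K\<lparr>carrier := V\<rparr>))"

definition residue_field :: "('a, 'b) ring_scheme \<Rightarrow> 'a set \<Rightarrow> 'a set ring" where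
  "residue_field K V = (K\<lparr>carrier := V\<rparr>) Quot (prime_ideal K V)"

text \<open>The residue field is a vector space over F through the image of F in it, which is the set
  of cosets of the elements of F.\<close>

definition deg :: "('a, 'b) ring_scheme \<Rightarrow> 'a set \<Rightarrow> 'a set \<Rightarrow> nat" where
  "deg K F V =
     ring.dim (residue_field K V)
       ((\<lambda>a. prime_ideal K V +>\<^bsub>K\<lparr>carrier := V\<rparr>\<^esub> a) ` F)
       (carrier (residue_field K V))"


section \<open>Divisors\<close>

text \<open>Divisors are finitely supported integer-valued functions on the primes. The primes P with
  P | D are exactly the elements of \<open>Poly_Mapping.keys D\<close>.\<close>

definition divisors :: "('a, 'b) ring_scheme \<Rightarrow> 'a set \<Rightarrow> ('a set \<Rightarrow>\<^sub>0 int) set" where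
  "divisors K F = carrier (free_Abelian_group (primes K F))"

definition effective_divisors :: "('a, 'b) ring_scheme \<Rightarrow> 'a set \<Rightarrow> ('a set \<Rightarrow>\<^sub>0 int) set" where
  "effective_divisors K F = {D \<in> divisors K F. \<forall>P. 0 \<le> Poly_Mapping.lookup D P}"

definition div_le ::
    "('a, 'b) ring_scheme \<Rightarrow> 'a set \<Rightarrow> ('a set \<Rightarrow>\<^sub>0 int) \<Rightarrow> ('a set \<Rightarrow>\<^sub>0 int) \<Rightarrow> bool" where
  "div_le K F B A \<longleftrightarrow> A - B \<in> effective_divisors K F"

text \<open>A divisor is a sum of distinct primes iff it is the sum of the primes in its support.\<close>

definition moebius :: "('p \<Rightarrow>\<^sub>0 int) \<Rightarrow> int" where
  "moebius D =
     (if D = 0 then 1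
      else if D = (\<Sum>P \<in> Poly_Mapping.keys D. frag_of P) then (- 1) ^ card (Poly_Mapping.keys D)
      else 0)"

definition degree_set ::
    "('a, 'b) ring_scheme \<Rightarrow> 'a set \<Rightarrow> ('a set \<Rightarrow>\<^sub>0 int) \<Rightarrow> nat set" where
  "degree_set K F D = deg K F ` Poly_Mapping.keys D"

definition Omega :: "('a, 'b) ring_scheme \<Rightarrow> 'a set \<Rightarrow> ('a set \<Rightarrow>\<^sub>0 int) \<Rightarrow> nat" where
  "Omega K F D = card (degree_set K F D)"

text \<open>Only k > 0 is meaningful in the next two definitions; the value at k = 0 is a dummy.
  The k-th smallest element has index k - 1 in the increasing list of degrees.\<close>

definition kth_smallest_degree ::
    "('a, 'b) ring_scheme \<Rightarrow> 'a set \<Rightarrow> nat \<Rightarrow> ('a set \<Rightarrow>\<^sub>0 int) \<Rightarrow> nat" where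
  "kth_smallest_degree K F k D =
     (if 1 \<le> k \<and> k \<le> Omega K F D
      then sorted_list_of_set (degree_set K F D) ! (k - 1) else 0)"

definition kth_largest_degree ::
    "('a, 'b) ring_scheme \<Rightarrow> 'a set \<Rightarrow> nat \<Rightarrow> ('a set \<Rightarrow>\<^sub>0 int) \<Rightarrow> nat" where
  "kth_largest_degree K F k D =
     (if 1 \<le> k \<and> k \<le> Omega K F D
      then rev (sorted_list_of_set (degree_set K F D)) ! (k - 1) else 0)"

definition P_min ::
    "('a, 'b) ring_scheme \<Rightarrow> 'a set \<Rightarrow> ('a set \<Rightarrow>\<^sub>0 int) \<Rightarrow> 'a set set" where
  "P_min K F D = {P \<in> Poly_Mapping.keys D. deg K F P = kth_smallest_degree K F 1 D}"

definition divisors_min_in ::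
    "('a, 'b) ring_scheme \<Rightarrow> 'a set \<Rightarrow> 'a set set \<Rightarrow> ('a set \<Rightarrow>\<^sub>0 int) set" where
  "divisors_min_in K F S = {D \<in> effective_divisors K F. \<exists>P \<in> S. P_min K F D = {P}}"

definition Q_count ::
    "('a, 'b) ring_scheme \<Rightarrow> 'a set \<Rightarrow> 'a set set \<Rightarrow> nat \<Rightarrow> ('a set \<Rightarrow>\<^sub>0 int) \<Rightarrow> nat" where
  "Q_count K F S k D =
     card {P \<in> S. P \<in> Poly_Mapping.keys D \<and> deg K F P = kth_largest_degree K F k D}"

end

theory Submission
  imports Defs
begin

text \<open>Only the divisors \<open>B = P + \<Sum>Y\<close> contribute, where P in S divides A and Y is a set of prime
  divisors of A of degree greater than deg P. For fixed P, toggling one prime of a given degree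
  cancels terms until Y may be replaced by its set of degrees, and the alternating sum of
  binomial coefficients that remains vanishes unless exactly k - 1 degrees of A exceed deg P,
  that is, unless deg P is the k-th largest degree of A.\<close>

section \<open>Alternating sums over power sets, and ranks in finite linear orders\<close>

lemma sum_Pow_insert:
  fixes g :: "'a set \<Rightarrow> 'b::comm_monoid_add"
  assumes "finite A" "a \<notin> A"
  shows "(\<Sum>Z\<in>Pow (insert a A). g Z) = (\<Sum>Z\<in>Pow A. g Z + g (insert a Z))"
proof -
  have "inj_on (insert a) (Pow A)"
    using assms(2) by (auto simp: inj_on_def)
  moreover have "Pow A \<inter> insert a ` Pow A = {}"
    using assms(2) by auto
  ultimately show ?thesis
    using assms(1) by (simp add: Pow_insert sum.union_disjoint sum.reindex sum.distrib)
qed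

text \<open>Adding an element pairs \<open>Z\<close> with \<open>insert a Z\<close>, of opposite
  sign, and so replaces \<open>g\<close> by a difference; this drives the inductions below.\<close>

lemma sum_Pow_insert_alternating:
  fixes g :: "'a set \<Rightarrow> 'b::ring_1"
  assumes "finite A" "a \<notin> A"
  shows "(\<Sum>Z\<in>Pow (insert a A). (- 1) ^ card Z * g Z) =
         (\<Sum>Z\<in>Pow A. (- 1) ^ card Z * (g Z - g (insert a Z)))"
  unfolding sum_Pow_insert[OF assms]
proof (intro sum.cong refl)
  fix Z assume "Z \<in> Pow A"
  then have "card (insert a Z) = Suc (card Z)"
    using assms by (auto intro!: card_insert_disjoint dest: finite_subset)
  then show "(- 1) ^ card Z * g Z + (- 1) ^ card (insert a Z) * g (insert a Z) =
             (- 1) ^ card Z * (g Z - g (insert a Z))"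
    by (simp add: algebra_simps)
qed

text \<open>Toggling \<open>a\<close> in \<open>Z\<close> flips the sign but leaves
  \<open>insert a Z\<close> unchanged, so the terms cancel in pairs.\<close>

lemma alternating_sum_insert_eq_0:
  fixes g :: "'a set \<Rightarrow> 'b::ring_1"
  assumes "finite A" "a \<in> A"
  shows "(\<Sum>Z\<in>Pow A. (- 1) ^ card Z * g (insert a Z)) = 0"
proof -
  have "(\<Sum>Z\<in>Pow (insert a (A - {a})). (- 1) ^ card Z * g (insert a Z)) = 0"
    using assms(1) by (subst sum_Pow_insert_alternating) auto
  then show ?thesis
    using assms(2) by (simp add: insert_absorb)
qed

text \<open>Surplus elements in a fibre of \<open>d\<close> cancel, so each value of
  \<open>d\<close> counts as one element. The induction keeps \<open>g\<close> arbitrary, since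
  adding \<open>a\<close> passes to the function \<open>g T - g (insert (d a) T)\<close>.\<close>

lemma alternating_sum_image:
  fixes g :: "'b set \<Rightarrow> 'c::ring_1"
  assumes "finite A"
  shows "(\<Sum>Z\<in>Pow A. (- 1) ^ card Z * g (d ` Z)) = (\<Sum>T\<in>Pow (d ` A). (- 1) ^ card T * g T)"
  using assms
proof (induction A arbitrary: g rule: finite_induct)
  case empty
  then show ?case by simp
next
  case (insert a A)
  have "(\<Sum>Z\<in>Pow (insert a A). (- 1) ^ card Z * g (d ` Z)) =
        (\<Sum>Z\<in>Pow A. (- 1) ^ card Z * (g (d ` Z) - g (insert (d a) (d ` Z))))"
    using insert.hyps by (simp add: sum_Pow_insert_alternating)
  also have "\<dots> = (\<Sum>T\<in>Pow (d ` A). (- 1) ^ card T * (g T - g (insert (d a) T)))"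
    by (rule insert.IH)
  also have "\<dots> = (\<Sum>T\<in>Pow (d ` insert a A). (- 1) ^ card T * g T)"
  \<comment> \<open>For an old value \<open>d a\<close> the power set on the right does not grow and
    the subtracted sum vanishes by toggling \<open>d a\<close>; for a new one both sides unfold
    alike.\<close>
  proof (cases "d a \<in> d ` A")
    case True
    then show ?thesis
      using insert.hyps alternating_sum_insert_eq_0[of "d ` A" "d a" g]
      by (simp add: right_diff_distrib sum_subtractf insert_absorb)
  next
    case False
    then show ?thesis
      using insert.hyps by (simp add: sum_Pow_insert_alternating)
  qed
  finally show ?case .
qed

text \<open>By Pascal's rule the difference for \<open>Z\<close> and \<open>insert a Z\<close> is
  minus the coefficient with lower index \<open>j - 1\<close>, so the size of the set and
  \<open>j\<close> drop together, each time with a sign.\<close>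

lemma alternating_sum_choose:
  assumes "finite A"
  shows "(\<Sum>Z\<in>Pow A. (- 1) ^ card Z * (of_nat (card Z choose j) :: 'b::ring_1)) =
         (if card A = j then (- 1) ^ j else 0)"
  using assms
proof (induction A arbitrary: j rule: finite_induct)
  case empty
  then show ?case by (cases j) auto
next
  case (insert a A)
  have card: "card (insert a Z) = Suc (card Z)" if "Z \<subseteq> A" for Z
    using that insert.hyps by (auto intro!: card_insert_disjoint dest: finite_subset)
  have "(\<Sum>Z\<in>Pow (insert a A). (- 1) ^ card Z * (of_nat (card Z choose j) :: 'b)) =
        (\<Sum>Z\<in>Pow A. (- 1) ^ card Z * (of_nat (card Z choose j) - of_nat (Suc (card Z) choose j)))"
    unfolding sum_Pow_insert_alternating[OF insert.hyps] by (intro sum.cong refl) (simp add: card)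
  also have "\<dots> = (if card (insert a A) = j then (- 1) ^ j else 0)"
    \<comment> \<open>The instance at \<open>j - 1\<close> serves \<open>j > 0\<close>; for
      \<open>j = 0\<close> every difference is \<open>1 - 1\<close>, and the enlarged set does not
      have size \<open>0\<close>.\<close>
    using insert.hyps insert.IH[of "j - 1"] by (cases j) (auto simp: sum_negf)
  finally show ?case .
qed

text \<open>An element of the increasing list is exceeded by exactly the entries after it, so their
  number fixes its rank from the top. Membership of \<open>e\<close> matters: a value in a gap of
  \<open>U\<close> has the same count as the next element below.\<close>

lemma rev_sorted_list_of_set_nth_eq_iff:
  fixes U :: "'a::linorder set"
  assumes "finite U" "e \<in> U" "1 \<le> k" "k \<le> card U"
  shows "rev (sorted_list_of_set U) ! (k - 1) = e \<longleftrightarrow> card {x \<in> U. e < x} = k - 1"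
proof -
  define l where "l = sorted_list_of_set U"
  have l: "sorted_wrt (<) l" "set l = U" "length l = card U" "distinct l"
    using assms(1) by (simp_all add: l_def)
  obtain i where i: "i < length l" "e = l ! i"
    using assms(2) l(2) by (metis in_set_conv_nth)
  have less_iff: "l ! a < l ! b \<longleftrightarrow> a < b" if "a < length l" "b < length l" for a b
    using that l(1) by (metis linorder_neqE_nat order_less_asym sorted_wrt_nth_less order_less_irrefl)
  have "{x \<in> U. e < x} = (!) l ` {i<..<length l}"
    using i less_iff l(2) by (fastforce simp: in_set_conv_nth image_iff)
  then have "card {x \<in> U. e < x} = length l - Suc i"
    using l(4) by (simp add: card_image inj_on_nth)
  moreover have "rev l ! (k - 1) = l ! (length l - k)"
    using assms l(3) by (simp add: rev_nth)
  moreover have "l ! (length l - k) = l ! i \<longleftrightarrow> length l - k = i"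
    using assms i l by (intro nth_eq_iff_index_eq) auto
  ultimately have "rev l ! (k - 1) = e \<longleftrightarrow> length l - k = i"
      "card {x \<in> U. e < x} = k - 1 \<longleftrightarrow> length l - Suc i = k - 1"
    using i(2) by simp_all
  moreover have "length l - k = i \<longleftrightarrow> length l - Suc i = k - 1"
    using assms(3,4) i(1) l(3) by linarith
  ultimately show ?thesis
    unfolding l_def by blast
qed

section \<open>Squarefree divisors and the order on effective divisors\<close>

lemma lookup_sum_frag_of:
  assumes "finite Z"
  shows "Poly_Mapping.lookup (\<Sum>P\<in>Z. frag_of P) Q = (if Q \<in> Z then 1 else 0)"
  using assms by (simp add: lookup_sum lookup_frag_of)

lemma keys_sum_frag_of:
  assumes "finite Z"
  shows "Poly_Mapping.keys (\<Sum>P\<in>Z. frag_of P) = Z"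
  by (rule Set.set_eqI) (simp add: in_keys_iff lookup_sum_frag_of[OF assms])

text \<open>The empty sum is the zero divisor, where the separate value \<open>1\<close> of
  \<open>moebius\<close> agrees with \<open>(- 1) ^ 0\<close>.\<close>

lemma moebius_sum_frag_of:
  assumes "finite Z"
  shows "moebius (\<Sum>P\<in>Z. frag_of P) = (- 1) ^ card Z"
  using assms keys_sum_frag_of[OF assms] by (auto simp: moebius_def)

lemma moebius_neq_0_imp:
  assumes "moebius D \<noteq> 0"
  shows "D = (\<Sum>P\<in>Poly_Mapping.keys D. frag_of P)"
  using assms by (auto simp: moebius_def split: if_splits)

lemma effective_divisors_iff:
  "D \<in> effective_divisors K F \<longleftrightarrow>
    Poly_Mapping.keys D \<subseteq> primes K F \<and> (\<forall>P. 0 \<le> Poly_Mapping.lookup D P)"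
  by (auto simp: effective_divisors_def divisors_def)

lemma div_le_iff:
  assumes "A \<in> effective_divisors K F" "B \<in> effective_divisors K F"
  shows "div_le K F B A \<longleftrightarrow> (\<forall>P. Poly_Mapping.lookup B P \<le> Poly_Mapping.lookup A P)"
  using assms keys_diff[of A B]
  by (auto simp: div_le_def effective_divisors_iff lookup_minus)

lemma keys_subset_of_div_le:
  assumes "A \<in> effective_divisors K F" "B \<in> effective_divisors K F" "div_le K F B A"
  shows "Poly_Mapping.keys B \<subseteq> Poly_Mapping.keys A"
proof
  fix P assume "P \<in> Poly_Mapping.keys B"
  moreover have "0 \<le> Poly_Mapping.lookup B P" "Poly_Mapping.lookup B P \<le> Poly_Mapping.lookup A P"
    using assms by (auto simp: div_le_iff effective_divisors_iff)
  ultimately show "P \<in> Poly_Mapping.keys A"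
    by (auto simp: in_keys_iff)
qed

text \<open>\<open>B\<close> vanishes off the support of \<open>A\<close> and has finitely many
  possible coefficients on it. Finiteness allows the terms with vanishing \<open>moebius\<close> to
  be dropped later.\<close>

lemma finite_effective_div_le:
  assumes "A \<in> effective_divisors K F"
  shows "finite {B \<in> effective_divisors K F. div_le K F B A}" (is "finite ?E")
proof (rule finite_imageD)
  let ?I = "\<Union>P\<in>Poly_Mapping.keys A. {0..Poly_Mapping.lookup A P}"
  have "Poly_Mapping.lookup ` ?E \<subseteq>
        {g. \<forall>P. (P \<in> Poly_Mapping.keys A \<longrightarrow> g P \<in> ?I) \<and> (P \<notin> Poly_Mapping.keys A \<longrightarrow> g P = 0)}"
  proof clarify
    fix B P assume B: "B \<in> effective_divisors K F" "div_le K F B A"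
    have "Poly_Mapping.lookup B P \<in> {0..Poly_Mapping.lookup A P}"
      using assms B by (auto simp: div_le_iff effective_divisors_iff)
    moreover have "P \<notin> Poly_Mapping.keys A \<longrightarrow> Poly_Mapping.lookup B P = 0"
      using keys_subset_of_div_le[OF assms B] by (auto simp: in_keys_iff)
    ultimately show "(P \<in> Poly_Mapping.keys A \<longrightarrow> Poly_Mapping.lookup B P \<in> ?I) \<and>
        (P \<notin> Poly_Mapping.keys A \<longrightarrow> Poly_Mapping.lookup B P = 0)"
      by blast
  qed
  then show "finite (Poly_Mapping.lookup ` ?E)"
    by (rule finite_subset) (intro finite_set_of_finite_funs; simp)
  show "inj_on Poly_Mapping.lookup ?E"
    by (simp add: inj_on_def poly_mapping_eqI)
qed

lemma sum_frag_of_effective_div_le: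
  assumes "A \<in> effective_divisors K F" "Z \<subseteq> Poly_Mapping.keys A"
  shows "(\<Sum>P\<in>Z. frag_of P) \<in> effective_divisors K F" "div_le K F (\<Sum>P\<in>Z. frag_of P) A"
proof -
  have Z: "finite Z"
    using assms(2) finite_keys finite_subset by blast
  show eff: "(\<Sum>P\<in>Z. frag_of P) \<in> effective_divisors K F"
    using assms Z by (auto simp: effective_divisors_iff lookup_sum_frag_of keys_sum_frag_of)
  have "Poly_Mapping.lookup A P \<ge> 1" if "P \<in> Z" for P
  proof -
    have "Poly_Mapping.lookup A P \<noteq> 0" "Poly_Mapping.lookup A P \<ge> 0"
      using assms that by (auto simp: effective_divisors_iff in_keys_iff)
    then show ?thesis by linarith
  qed
  then show "div_le K F (\<Sum>P\<in>Z. frag_of P) A"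
    using assms(1) eff Z by (auto simp: div_le_iff lookup_sum_frag_of effective_divisors_iff)
qed

section \<open>Extremal degrees, and divisors with a unique prime of least degree\<close>

lemma kth_smallest_degree_1:
  assumes "D \<noteq> 0"
  shows "kth_smallest_degree K F 1 D = Min (degree_set K F D)"
proof -
  have U: "finite (degree_set K F D)" "degree_set K F D \<noteq> {}"
    using assms by (auto simp: degree_set_def)
  then have "1 \<le> Omega K F D"
    by (simp add: Omega_def Suc_le_eq card_gt_0_iff)
  then show ?thesis
    using U by (simp add: kth_smallest_degree_def sorted_list_of_set_nonempty)
qed

text \<open>A second prime of degree at most that of \<open>P\<close> would join \<open>P\<close> in
  \<open>P_min\<close> or displace it. This form shows how the support splits into \<open>P\<close>
  and primes of strictly larger degree.\<close>

lemma P_min_eq_singleton_iff: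
  "P_min K F D = {P} \<longleftrightarrow>
    P \<in> Poly_Mapping.keys D \<and> (\<forall>Q\<in>Poly_Mapping.keys D - {P}. deg K F P < deg K F Q)"
proof (cases "D = 0")
  case True
  then show ?thesis by (simp add: P_min_def)
next
  case False
  have U: "finite (degree_set K F D)" "degree_set K F D \<noteq> {}"
    using False by (auto simp: degree_set_def)
  have min: "deg K F Q = kth_smallest_degree K F 1 D \<longleftrightarrow>
      (\<forall>R\<in>Poly_Mapping.keys D. deg K F Q \<le> deg K F R)" if "Q \<in> Poly_Mapping.keys D" for Q
  proof -
    have "deg K F Q \<in> degree_set K F D"
      using that by (simp add: degree_set_def)
    then have "deg K F Q = Min (degree_set K F D) \<longleftrightarrow> (\<forall>e\<in>degree_set K F D. deg K F Q \<le> e)"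
      using U by (metis Min_eqI Min_le)
    then show ?thesis
      unfolding kth_smallest_degree_1[OF False] by (simp add: degree_set_def)
  qed
  have P_min_eq: "P_min K F D =
      {Q \<in> Poly_Mapping.keys D. \<forall>R\<in>Poly_Mapping.keys D. deg K F Q \<le> deg K F R}"
    using min by (auto simp: P_min_def)
  show ?thesis
  proof
    assume P: "P_min K F D = {P}"
    have "deg K F P < deg K F R" if "R \<in> Poly_Mapping.keys D - {P}" for R
    proof (rule ccontr)
      assume "\<not> deg K F P < deg K F R"
      moreover have "P \<in> P_min K F D" "R \<notin> P_min K F D"
        using P that by auto
      ultimately show False
        unfolding P_min_eq using that by (auto simp: not_less dest: order_trans)
    qed
    then show "P \<in> Poly_Mapping.keys D \<and> (\<forall>Q\<in>Poly_Mapping.keys D - {P}. deg K F P < deg K F Q)"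
      using P by (auto simp: P_min_def)
  next
    assume "P \<in> Poly_Mapping.keys D \<and> (\<forall>Q\<in>Poly_Mapping.keys D - {P}. deg K F P < deg K F Q)"
    then have P: "P \<in> Poly_Mapping.keys D"
      and less: "\<And>R. R \<in> Poly_Mapping.keys D \<Longrightarrow> R \<noteq> P \<Longrightarrow> deg K F P < deg K F R"
      by auto
    have "(\<forall>R\<in>Poly_Mapping.keys D. deg K F R' \<le> deg K F R) \<longleftrightarrow> R' = P"
      if "R' \<in> Poly_Mapping.keys D" for R'
      using less P that by (metis leD less_imp_le order_refl)
    then show "P_min K F D = {P}"
      unfolding P_min_eq using P by blast
  qed
qed

lemma kth_smallest_degree_1_of_P_min:
  assumes "P_min K F D = {P}"
  shows "kth_smallest_degree K F 1 D = deg K F P"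
  using assms by (auto simp: P_min_def)

text \<open>Degrees are counted, not primes, since several primes may share a degree; the
  alternating sums produce this count. The bounds on \<open>k\<close> rule out the default value
  \<open>0\<close> of \<open>kth_largest_degree\<close>.\<close>

lemma kth_largest_degree_eq_iff:
  assumes "P \<in> Poly_Mapping.keys A" "1 \<le> k" "k \<le> Omega K F A"
  shows "deg K F P = kth_largest_degree K F k A \<longleftrightarrow>
         card (deg K F ` {Q \<in> Poly_Mapping.keys A. deg K F P < deg K F Q}) = k - 1"
proof -
  have "deg K F ` {Q \<in> Poly_Mapping.keys A. deg K F P < deg K F Q} =
        {e \<in> degree_set K F A. deg K F P < e}"
    by (auto simp: degree_set_def)
  moreover have "kth_largest_degree K F k A = rev (sorted_list_of_set (degree_set K F A)) ! (k - 1)"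
    using assms by (simp add: kth_largest_degree_def)
  moreover have "finite (degree_set K F A)" "deg K F P \<in> degree_set K F A"
    using assms(1) by (simp_all add: degree_set_def)
  ultimately show ?thesis
    using rev_sorted_list_of_set_nth_eq_iff[of "degree_set K F A" "deg K F P" k] assms(2,3)
    by (simp only: eq_commute[of "deg K F P"] Omega_def)
qed

text \<open>\<open>moebius\<close> leaves only squarefree \<open>B\<close>, which correspond
  bijectively to pairs of their prime \<open>P\<close> of least degree and the set \<open>Y\<close>
  of their other primes. The minus sign is the contribution of \<open>P\<close> to
  \<open>moebius\<close>.\<close>

lemma sum_divisors_min_in:
  fixes h :: "('a set \<Rightarrow>\<^sub>0 int) \<Rightarrow> complex"
  assumes "A \<in> effective_divisors K F"
  defines "N \<equiv> Poly_Mapping.keys A"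
  defines "M \<equiv> \<lambda>P. {Q \<in> N. deg K F P < deg K F Q}"
  shows "(\<Sum>B\<in>{B \<in> divisors_min_in K F S. div_le K F B A}. of_int (moebius B) * h B) =
         (\<Sum>P\<in>S \<inter> N. \<Sum>Y\<in>Pow (M P). - ((- 1) ^ card Y * h (\<Sum>Q\<in>insert P Y. frag_of Q)))"
proof -
  have finN: "finite N" and finM: "finite (M P)" for P
    by (auto simp: N_def M_def)
  let ?L = "{B \<in> divisors_min_in K F S. div_le K F B A}"
  let ?b = "\<lambda>(P, Y). \<Sum>Q\<in>insert P Y. frag_of Q :: 'a set \<Rightarrow>\<^sub>0 int"
  let ?I = "SIGMA P:S \<inter> N. Pow (M P)"
  have fin: "finite ?L"
    by (rule finite_subset[OF _ finite_effective_div_le[OF assms(1)]])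
       (auto simp: divisors_min_in_def)
  have finY: "finite Y" if "Y \<subseteq> M P" for P Y
    using that finM finite_subset by blast
  have PmM: "P_min K F (?b (P, Y)) = {P}" if "Y \<subseteq> M P" for P Y
    using that finY[OF that] by (auto simp: P_min_eq_singleton_iff keys_sum_frag_of M_def simp del: sum.insert)
  \<comment> \<open>\<open>P_min\<close> recovers \<open>P\<close> from the sum, the support
    recovers \<open>insert P Y\<close>, and removing \<open>P\<close> recovers
    \<open>Y\<close>.\<close>
  have "P = P' \<and> Y = Y'" if a: "Y \<subseteq> M P" "Y' \<subseteq> M P'" and eq: "?b (P, Y) = ?b (P', Y')"
    for P Y P' Y'
  proof -
    have "P = P'"
      using PmM[OF a(1)] PmM[OF a(2)] unfolding eq by simp
    moreover have "insert P Y = insert P' Y'"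
      using arg_cong[OF eq, of Poly_Mapping.keys] a finY
      by (simp add: keys_sum_frag_of del: sum.insert)
    moreover have "P \<notin> Y" "P' \<notin> Y'"
      using a by (auto simp: M_def)
    ultimately show ?thesis
      by (metis insert_ident)
  qed
  then have inj: "inj_on ?b ?I"
    unfolding inj_on_def by blast
  have "?b (P, Y) \<in> ?L" if PY: "P \<in> S" "P \<in> N" "Y \<subseteq> M P" for P Y
  proof -
    have "insert P Y \<subseteq> Poly_Mapping.keys A"
      using PY by (auto simp: M_def N_def)
    note * = sum_frag_of_effective_div_le[OF assms(1) this]
    then show ?thesis
      using PmM[OF PY(3)] PY(1) by (simp add: divisors_min_in_def del: sum.insert)
  qed
  then have sub: "?b ` ?I \<subseteq> ?L"
    by blast
  \<comment> \<open>A divisor with nonzero \<open>moebius\<close> is the sum of its support, so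
    splitting off its prime of least degree exhibits it as a value of \<open>?b\<close>.\<close>
  have zero: "moebius B = 0" if B_in: "B \<in> ?L - ?b ` ?I" for B
  proof (rule ccontr)
    assume "moebius B \<noteq> 0"
    note B = moebius_neq_0_imp[OF this]
    obtain P where P: "P \<in> S" "P_min K F B = {P}" and eff: "B \<in> effective_divisors K F"
      using DiffD1[OF B_in] by (auto simp: divisors_min_in_def)
    have keys: "Poly_Mapping.keys B \<subseteq> N"
      using B_in keys_subset_of_div_le[OF assms(1) eff] by (simp add: N_def)
    note min = P(2)[unfolded P_min_eq_singleton_iff]
    have "B = ?b (P, Poly_Mapping.keys B - {P})"
      using B min by (simp add: insert_absorb del: sum.insert)
    moreover have "(P, Poly_Mapping.keys B - {P}) \<in> ?I"
      using P(1) min keys by (auto simp: M_def)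
    ultimately show False
      using B_in by blast
  qed
  have "(\<Sum>B\<in>?L. of_int (moebius B) * h B) = (\<Sum>B\<in>?b ` ?I. of_int (moebius B) * h B)"
    using fin sub zero by (intro sum.mono_neutral_right) auto
  also have "\<dots> = (\<Sum>(P, Y)\<in>?I. of_int (moebius (?b (P, Y))) * h (?b (P, Y)))"
    using inj by (simp add: sum.reindex case_prod_unfold del: sum.insert)
  also have "\<dots> = (\<Sum>P\<in>S \<inter> N. \<Sum>Y\<in>Pow (M P). of_int (moebius (?b (P, Y))) * h (?b (P, Y)))"
    using finN finM by (simp add: sum.Sigma del: sum.insert)
  also have "\<dots> = (\<Sum>P\<in>S \<inter> N. \<Sum>Y\<in>Pow (M P). - ((- 1) ^ card Y * h (\<Sum>Q\<in>insert P Y. frag_of Q)))"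
  proof (intro sum.cong refl)
    fix P Y assume "Y \<in> Pow (M P)"
    then have "finite Y" "P \<notin> Y"
      using finY by (auto simp: M_def)
    then show "of_int (moebius (?b (P, Y))) * h (?b (P, Y)) =
               - ((- 1) ^ card Y * h (\<Sum>Q\<in>insert P Y. frag_of Q))"
      by (simp add: moebius_sum_frag_of del: sum.insert)
  qed
  finally show ?thesis .
qed

section \<open>Evaluation of the sum for each prime of least degree\<close>

theorem theorem3p1:
  fixes K :: "('a, 'b) ring_scheme" and F :: "'a set" and S :: "'a set set"
    and f :: "nat \<Rightarrow> complex" and A :: "'a set \<Rightarrow>\<^sub>0 int" and k :: nat
  assumes "global_function_field K F"
    and "constant_field K F = F"
    and "S \<subseteq> primes K F"
    and "f 0 = 0"
    and "A \<in> effective_divisors K F"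
    and "k > 0"
  shows "(\<Sum>B \<in> {B \<in> divisors_min_in K F S. div_le K F B A}.
            of_int (moebius B) * of_nat ((Omega K F B - 1) choose (k - 1))
              * f (kth_smallest_degree K F 1 B))
         = (- 1) ^ k * of_nat (Q_count K F S k A) * f (kth_largest_degree K F k A)"
proof -
  define N where "N = Poly_Mapping.keys A"
  define M where "M = (\<lambda>P. {Q \<in> N. deg K F P < deg K F Q})"
  define h where "h = (\<lambda>B. of_nat ((Omega K F B - 1) choose (k - 1)) *
    f (kth_smallest_degree K F 1 B))"
  have finN: "finite N" and finM: "finite (M P)" for P
    by (auto simp: N_def M_def)
  \<comment> \<open>The degree of \<open>P\<close> differs from all degrees in \<open>Y\<close>, so
    it adds one to \<open>Omega\<close>, which the subtracted \<open>1\<close> removes. The value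
    depends on \<open>Y\<close> only through its set of degrees, as
    \<open>alternating_sum_image\<close> requires.\<close>
  have h: "h (\<Sum>Q\<in>insert P Y. frag_of Q) =
      of_nat (card (deg K F ` Y) choose (k - 1)) * f (deg K F P)" if "Y \<in> Pow (M P)" for P Y
  proof -
    have Y: "finite Y" "deg K F P \<notin> deg K F ` Y"
      using that finM[of P] finite_subset by (auto simp: M_def)
    have "P_min K F (\<Sum>Q\<in>insert P Y. frag_of Q) = {P}"
      using that Y by (auto simp: P_min_eq_singleton_iff keys_sum_frag_of M_def simp del: sum.insert)
    moreover have "Omega K F (\<Sum>Q\<in>insert P Y. frag_of Q) = Suc (card (deg K F ` Y))"
      using Y by (simp add: Omega_def degree_set_def keys_sum_frag_of del: sum.insert)
    ultimately show ?thesis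
      by (simp add: h_def kth_smallest_degree_1_of_P_min del: One_nat_def sum.insert)
  qed
  have alt: "(\<Sum>Y\<in>Pow (M P). (- 1) ^ card Y * of_nat (card (deg K F ` Y) choose (k - 1))) =
      (if card (deg K F ` M P) = k - 1 then (- 1) ^ (k - 1) else 0 :: complex)" for P
    using alternating_sum_image[OF finM, where d = "deg K F"
        and g = "\<lambda>T. of_nat (card T choose (k - 1)) :: complex"]
    by (simp add: alternating_sum_choose finM del: One_nat_def)
  have "(\<Sum>B \<in> {B \<in> divisors_min_in K F S. div_le K F B A}.
            of_int (moebius B) * of_nat ((Omega K F B - 1) choose (k - 1))
              * f (kth_smallest_degree K F 1 B)) =
        (\<Sum>B \<in> {B \<in> divisors_min_in K F S. div_le K F B A}. of_int (moebius B) * h B)"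
    by (simp add: h_def mult.assoc)
  also have "\<dots> = (\<Sum>P\<in>S \<inter> N. \<Sum>Y\<in>Pow (M P).
      - ((- 1) ^ card Y * h (\<Sum>Q\<in>insert P Y. frag_of Q)))"
    unfolding N_def M_def by (rule sum_divisors_min_in[OF assms(5)])
  also have "\<dots> = (\<Sum>P\<in>S \<inter> N. - f (deg K F P) *
      (\<Sum>Y\<in>Pow (M P). (- 1) ^ card Y * of_nat (card (deg K F ` Y) choose (k - 1))))"
    by (simp add: h sum_distrib_left mult_ac del: sum.insert)
  also have "\<dots> = (\<Sum>P\<in>S \<inter> N. - f (deg K F P) *
      (if card (deg K F ` M P) = k - 1 then (- 1) ^ (k - 1) else 0))"
    by (simp only: alt)
  \<comment> \<open>As \<open>k > 0\<close>, the minus sign turns \<open>(- 1) ^ (k - 1)\<close>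
    into \<open>(- 1) ^ k\<close>.\<close>
  also have "\<dots> = (\<Sum>P\<in>S \<inter> N. if card (deg K F ` M P) = k - 1 then (- 1) ^ k * f (deg K F P) else 0)"
    using assms(6) by (intro sum.cong refl) (cases k; simp)
  also have "\<dots> = (- 1) ^ k * of_nat (Q_count K F S k A) * f (kth_largest_degree K F k A)"
  proof (cases "k \<le> Omega K F A")
    case True
    \<comment> \<open>Every surviving prime has the k-th largest degree, so \<open>f\<close> takes
      one value and the sum counts these primes.\<close>
    have "(\<Sum>P\<in>S \<inter> N. if card (deg K F ` M P) = k - 1 then (- 1) ^ k * f (deg K F P) else 0) =
        (\<Sum>P\<in>S \<inter> N. if deg K F P = kth_largest_degree K F k A
            then (- 1) ^ k * f (kth_largest_degree K F k A) else 0)"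
      using kth_largest_degree_eq_iff[of _ A k K F, symmetric] True assms(6)
      by (intro sum.cong refl) (simp add: N_def M_def del: One_nat_def)
    also have "\<dots> = of_nat (card {P \<in> S \<inter> N. deg K F P = kth_largest_degree K F k A}) *
        ((- 1) ^ k * f (kth_largest_degree K F k A))"
      using finN by (simp flip: sum.inter_filter)
    also have "{P \<in> S \<inter> N. deg K F P = kth_largest_degree K F k A} =
        {P \<in> S. P \<in> Poly_Mapping.keys A \<and> deg K F P = kth_largest_degree K F k A}"
      by (auto simp: N_def)
    finally show ?thesis
      by (simp add: Q_count_def mult_ac)
  next
    case False
    \<comment> \<open>Both sides are zero. The degree of \<open>P\<close> does not exceed itself, so
      fewer than \<open>Omega K F A\<close> \<le> \<open>k - 1\<close> degrees are larger; on the
      right \<open>kth_largest_degree\<close> takes its default \<open>0\<close>, and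
      \<open>f 0 = 0\<close>.\<close>
    have "card (deg K F ` M P) \<noteq> k - 1" if "P \<in> N" for P
    proof -
      have "deg K F ` M P \<subseteq> degree_set K F A" "deg K F P \<in> degree_set K F A - deg K F ` M P"
        using that by (auto simp: M_def N_def degree_set_def)
      then have "deg K F ` M P \<subset> degree_set K F A"
        by blast
      then have "card (deg K F ` M P) < Omega K F A"
        unfolding Omega_def by (intro psubset_card_mono) (auto simp: degree_set_def)
      then show ?thesis
        using False by simp
    qed
    then show ?thesis
      using False assms(4) by (auto simp: kth_largest_degree_def intro!: sum.neutral)
  qed
  finally show ?thesis .
qed

end
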